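(* Let $X$ be a shift space on a finite alphabet $A$ with an ergodic measure $\mu$ and let $\varphi\colon A^*\to G$ be a (monoid) morphism onto a finite group $G$ with uniform probability measure $\nu$. If the product measure $\nu\times\mu$ is ergodic on the skew product $G\rtimes_\varphi X$, then for every group language $L=\varphi^{-1}(K)$ with $K\subseteq G$, $\delta_\mu(L)=|K|/|G|$.
   Context: A shift space on a finite alphabet $A$ is a nonempty closed subset $X\subseteq A^{\mathbb Z}$ invariant under the shift map $S((x_n)_n)=(x_{n+1})_n$, such that every letter of $A$ occurs in some element of $X$. Write $x_{[i,j)}=x_i\cdots x_{j-1}$. An ergodic measure on $X$ is a shift-invariant ergodic Borel probability measure. The density of $L\subseteq A^*$ under $\mu$ is $\delta_\mu(L)=\lim_{n\to\infty}\frac1n\sum_{i=0}^{n-1}\mu(\{x\in X:x_{[0,i)}\in L\})$. The skew product $G\rtimes_\varphi X$ is the dynamical system $(G\times X,T_\varphi)$, $G$ discrete, with $T_\varphi(g,x)=(g\varphi(x_0),Sx)$; ergodicity of $\nu\times\mu$ is with respect to $T_\varphi$. *)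

theory Defs
  imports "HOL-Probability.Probability" "HOL-Algebra.Group"
begin

definition shift_map :: "(int \<Rightarrow> 'a) \<Rightarrow> (int \<Rightarrow> 'a)" where
  "shift_map x = (\<lambda>n. x (n + 1))"

definition full_shift_topology :: "'a set \<Rightarrow> (int \<Rightarrow> 'a) topology" where
  "full_shift_topology A = product_topology (\<lambda>_. discrete_topology A) UNIV"

definition shift_space :: "'a set \<Rightarrow> (int \<Rightarrow> 'a) set \<Rightarrow> bool" where
  "shift_space A X \<longleftrightarrow>
     finite A \<and> X \<noteq> {} \<and> closedin (full_shift_topology A) X \<and> shift_map ` X = X \<and>
     (\<forall>a\<in>A. \<exists>x\<in>X. \<exists>n. x n = a)"

definition shift_borel :: "'a set \<Rightarrow> (int \<Rightarrow> 'a) set \<Rightarrow> (int \<Rightarrow> 'a) measure" where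
  "shift_borel A X = sigma X {U. openin (subtopology (full_shift_topology A) X) U}"

definition ergodic :: "'b measure \<Rightarrow> ('b \<Rightarrow> 'b) \<Rightarrow> bool" where
  "ergodic M T \<longleftrightarrow>
     prob_space M \<and> T \<in> measurable M M \<and> distr M M T = M \<and>
     (\<forall>B\<in>sets M. T -` B \<inter> space M = B \<longrightarrow> measure M B = 0 \<or> measure M B = 1)"

definition ergodic_measure_on :: "'a set \<Rightarrow> (int \<Rightarrow> 'a) set \<Rightarrow> (int \<Rightarrow> 'a) measure \<Rightarrow> bool" where
  "ergodic_measure_on A X \<mu> \<longleftrightarrow> sets \<mu> = sets (shift_borel A X) \<and> ergodic \<mu> shift_map"

definition free_monoid :: "'a set \<Rightarrow> 'a list monoid" where
  "free_monoid A = \<lparr>carrier = lists A, mult = (@), one = []\<rparr>"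

text \<open>Morphisms in the sense of \<open>hom\<close> (hence \<open>epi\<close>) need not preserve the unit, so this is
  required separately.\<close>

definition onto_monoid_morphism :: "'a set \<Rightarrow> ('g, 'm) monoid_scheme \<Rightarrow> ('a list \<Rightarrow> 'g) \<Rightarrow> bool" where
  "onto_monoid_morphism A G \<phi> \<longleftrightarrow> \<phi> \<in> epi (free_monoid A) G \<and> \<phi> [] = \<one>\<^bsub>G\<^esub>"

definition skew_map ::
  "('g, 'm) monoid_scheme \<Rightarrow> ('a list \<Rightarrow> 'g) \<Rightarrow> 'g \<times> (int \<Rightarrow> 'a) \<Rightarrow> 'g \<times> (int \<Rightarrow> 'a)" where
  "skew_map G \<phi> = (\<lambda>(g, x). (g \<otimes>\<^bsub>G\<^esub> \<phi> [x 0], shift_map x))"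

text \<open>The factor of \<open>x\<close> on the half-open interval from \<open>i\<close> to \<open>j\<close>; \<open>j\<close> is excluded.\<close>

definition factor :: "(int \<Rightarrow> 'a) \<Rightarrow> int \<Rightarrow> int \<Rightarrow> 'a list" where
  "factor x i j = map x [i..j - 1]"

text \<open>A relation rather than a limit operator, so that the existence of the limit is part of any
  claim about a density.\<close>

definition has_language_density :: "(int \<Rightarrow> 'a) measure \<Rightarrow> 'a list set \<Rightarrow> real \<Rightarrow> bool" where
  "has_language_density \<mu> L d \<longleftrightarrow>
     (\<lambda>n. (1 / real n) * (\<Sum>i<n. measure \<mu> {x \<in> space \<mu>. factor x 0 (int i) \<in> L}))
       \<longlonglongrightarrow> d"

end

theory Submission
  imports Defs
begin

text \<open>
  Under \<open>T = skew_map G \<phi>\<close> the \<open>i\<close>-th iterate of \<open>(\<one>, x)\<close> is \<open>(\<phi> (factor x 0 i), S\<^sup>i x)\<close>. Hence the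
  measure of the words of length \<open>i\<close> in \<open>L\<close> is, up to the factor \<open>|G|\<close>, the product measure of
  \<open>U \<inter> T\<^sup>-\<^sup>i V\<close> with \<open>U = {\<one>} \<times> X\<close> and \<open>V = K \<times> X\<close>. For an ergodic system the Cesaro means
  of these measures tend to the product of the measures of \<open>U\<close> and \<open>V\<close>, which is
  \<open>|K| / |G|\<^sup>2\<close>.

  The Cesaro statement follows by dominated convergence from the pointwise ergodic theorem. For the
  latter it suffices that, for \<open>h\<close> of negative integral, the Birkhoff sums of \<open>h\<close> are almost
  everywhere bounded above: the set where they are unbounded is strictly invariant, and it cannot
  have full measure by the maximal ergodic inequality.
\<close>

section \<open>The pointwise ergodic theorem\<close>

definition birkhoff_sum :: "('b \<Rightarrow> 'b) \<Rightarrow> ('b \<Rightarrow> real) \<Rightarrow> nat \<Rightarrow> 'b \<Rightarrow> real" where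
  "birkhoff_sum T f n x = (\<Sum>i<n. f ((T ^^ i) x))"

lemma birkhoff_sum_0 [simp]: "birkhoff_sum T f 0 x = 0"
  by (simp add: birkhoff_sum_def)

lemma birkhoff_sum_Suc: "birkhoff_sum T f (Suc n) x = f x + birkhoff_sum T f n (T x)"
  unfolding birkhoff_sum_def
  by (subst sum.lessThan_Suc_shift) (simp add: funpow_swap1)

lemma birkhoff_sum_diff_const:
  "birkhoff_sum T (\<lambda>y. f y - c) n x = birkhoff_sum T f n x - real n * c"
  by (simp add: birkhoff_sum_def sum_subtractf)

lemma birkhoff_sum_const_diff:
  "birkhoff_sum T (\<lambda>y. c - f y) n x = real n * c - birkhoff_sum T f n x"
  by (simp add: birkhoff_sum_def sum_subtractf)

lemma borel_measurable_birkhoff_sum: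
  assumes "T \<in> measurable M M" and "f \<in> borel_measurable M"
  shows "birkhoff_sum T f n \<in> borel_measurable M"
  unfolding birkhoff_sum_def
  using measurable_compose[OF measurable_compose_n[OF assms(1)] assms(2)] by measurable

text \<open>The recursive form of \<open>max {birkhoff_sum T h k x | k \<le> n}\<close>.\<close>

primrec birkhoff_max :: "('b \<Rightarrow> 'b) \<Rightarrow> ('b \<Rightarrow> real) \<Rightarrow> nat \<Rightarrow> 'b \<Rightarrow> real" where
  "birkhoff_max T h 0 x = 0"
| "birkhoff_max T h (Suc n) x = max 0 (h x + birkhoff_max T h n (T x))"

lemma birkhoff_max_nonneg: "0 \<le> birkhoff_max T h n x"
  by (cases n) auto

lemma birkhoff_max_le_Suc: "birkhoff_max T h n x \<le> birkhoff_max T h (Suc n) x"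
proof (induction n arbitrary: x)
  case 0
  show ?case by simp
next
  case (Suc n)
  show ?case using Suc[of "T x"] by (simp add: max_def)
qed

lemma birkhoff_max_mono: "m \<le> n \<Longrightarrow> birkhoff_max T h m x \<le> birkhoff_max T h n x"
  using birkhoff_max_le_Suc by (rule lift_Suc_mono_le)

lemma birkhoff_sum_le_max: "birkhoff_sum T h n x \<le> birkhoff_max T h n x"
proof (induction n arbitrary: x)
  case 0
  show ?case by simp
next
  case (Suc n)
  show ?case using Suc[of "T x"] by (simp add: birkhoff_sum_Suc)
qed

section \<open>The maximal ergodic inequality\<close>

lemma integrable_birkhoff_max:
  assumes T: "T \<in> measurable M M" "distr M M T = M" and h: "integrable M h"
  shows "integrable M (birkhoff_max T h n)"
proof (induction n)
  case 0
  show ?case by simp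
next
  case (Suc n)
  have "integrable M (\<lambda>x. birkhoff_max T h n (T x))"
    by (rule integrable_distr[OF T(1)]) (simp add: T(2) Suc)
  with h show ?case by simp
qed

text \<open>Garsia's argument: where the maximum for \<open>Suc n\<close> is positive, it exceeds
  the maximum for \<open>n\<close> at \<open>T x\<close> by exactly \<open>h x\<close>; elsewhere it
  is 0 and the difference is at most 0. By invariance of the measure and monotonicity in
  \<open>n\<close>, this difference has nonnegative integral.\<close>

lemma maximal_ergodic_inequality:
  assumes T: "T \<in> measurable M M" "distr M M T = M" and h: "integrable M h"
  shows "0 \<le> (\<integral>x. indicator {x \<in> space M. 0 < birkhoff_max T h (Suc n) x} x * h x \<partial>M)"
proof -
  let ?m = "birkhoff_max T h"
  note int = integrable_birkhoff_max[OF T h]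
  have intT: "integrable M (\<lambda>x. ?m n (T x))"
    by (rule integrable_distr[OF T(1)]) (simp add: T(2) int)
  have "(\<integral>x. ?m n (T x) \<partial>M) = (\<integral>x. ?m n x \<partial>distr M M T)"
    by (rule integral_distr[symmetric, OF T(1)]) (use int in auto)
  then have "(\<integral>x. ?m n (T x) \<partial>M) = (\<integral>x. ?m n x \<partial>M)"
    by (simp add: T(2))
  also have "\<dots> \<le> (\<integral>x. ?m (Suc n) x \<partial>M)"
    by (rule integral_mono[OF int int birkhoff_max_le_Suc])
  finally have "0 \<le> (\<integral>x. ?m (Suc n) x - ?m n (T x) \<partial>M)"
    using int[of "Suc n"] intT
    by (subst Bochner_Integration.integral_diff) (auto simp del: birkhoff_max.simps)
  also have "\<dots> \<le> (\<integral>x. indicator {x \<in> space M. 0 < ?m (Suc n) x} x * h x \<partial>M)"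
  proof (rule integral_mono)
    show "integrable M (\<lambda>x. ?m (Suc n) x - ?m n (T x))"
      using int[of "Suc n"] intT by (rule Bochner_Integration.integrable_diff)
    have "{x \<in> space M. 0 < ?m (Suc n) x} \<in> sets M"
      using borel_measurable_integrable[OF int[of "Suc n"]] by measurable
    then show "integrable M (\<lambda>x. indicator {x \<in> space M. 0 < ?m (Suc n) x} x * h x)"
      using integrable_mult_indicator[OF _ h] by simp
    show "?m (Suc n) x - ?m n (T x) \<le> indicator {x \<in> space M. 0 < ?m (Suc n) x} x * h x"
      if "x \<in> space M" for x
      using that birkhoff_max_nonneg[of T h n "T x"] by (auto simp: indicator_def max_def)
  qed
  finally show ?thesis .
qed

lemma integral_nonneg_if_AE_birkhoff_sum_pos:
  assumes T: "T \<in> measurable M M" "distr M M T = M" and h: "integrable M h"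
    and pos: "AE x in M. \<exists>n. 0 < birkhoff_sum T h n x"
  shows "0 \<le> (\<integral>x. h x \<partial>M)"
proof (rule LIMSEQ_le_const)
  let ?P = "\<lambda>n. {x \<in> space M. 0 < birkhoff_max T h (Suc n) x}"
  have P: "?P n \<in> sets M" for n
    using borel_measurable_integrable[OF integrable_birkhoff_max[OF T h, of "Suc n"]] by measurable
  show "(\<lambda>n. \<integral>x. indicator (?P n) x * h x \<partial>M) \<longlonglongrightarrow> (\<integral>x. h x \<partial>M)"
  proof (rule integral_dominated_convergence[where w="\<lambda>x. \<bar>h x\<bar>"])
    show "h \<in> borel_measurable M" and "integrable M (\<lambda>x. \<bar>h x\<bar>)"
      using h by auto
    show "(\<lambda>x. indicator (?P n) x * h x) \<in> borel_measurable M" for n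
      using h P[of n] by measurable
    show "AE x in M. norm (indicator (?P n) x * h x) \<le> \<bar>h x\<bar>" for n
      by (auto simp: indicator_def)
    show "AE x in M. (\<lambda>n. indicator (?P n) x * h x) \<longlonglongrightarrow> h x"
      using pos AE_space
    proof eventually_elim
      case (elim x)
      then obtain N where N: "0 < birkhoff_sum T h N x" by blast
      \<comment> \<open>The maxima increase with \<open>n\<close>, so one positive sum at time
        \<open>N\<close> keeps \<open>x\<close> in \<open>?P n\<close> from then on.\<close>
      have "indicator (?P n) x * h x = h x" if "N \<le> n" for n
        using N birkhoff_sum_le_max[of T h N x] birkhoff_max_mono[of N "Suc n" T h x] that elim(2)
        by (auto simp: indicator_def simp del: birkhoff_max.simps)
      then show ?case
        by (intro tendsto_eventually eventually_sequentiallyI)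
    qed
  qed
  show "\<exists>N. \<forall>n\<ge>N. 0 \<le> (\<integral>x. indicator (?P n) x * h x \<partial>M)"
    using maximal_ergodic_inequality[OF T h] by blast
qed

section \<open>From bounded sums to almost everywhere convergence\<close>

lemma ergodic_birkhoff_sum_bounded_above:
  assumes erg: "ergodic M T" and h: "integrable M h" and neg: "(\<integral>x. h x \<partial>M) < 0"
  shows "AE x in M. \<exists>C. \<forall>n. birkhoff_sum T h n x \<le> C"
proof -
  interpret prob_space M using erg by (simp add: ergodic_def)
  have T: "T \<in> measurable M M" "distr M M T = M" using erg by (auto simp: ergodic_def)
  define B where "B = {x \<in> space M. \<forall>k::nat. \<exists>n. real k < birkhoff_sum T h n x}"
  have [measurable]: "birkhoff_sum T h n \<in> borel_measurable M" for n
    using borel_measurable_birkhoff_sum[OF T(1) borel_measurable_integrable[OF h]] .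
  have B: "B \<in> sets M" unfolding B_def by measurable
  \<comment> \<open>Natural thresholds make \<open>B\<close> measurable as a countable combination;
    real thresholds are the ones that can be translated by \<open>h x\<close>.\<close>
  have unb_iff: "(\<forall>k::nat. \<exists>n. real k < birkhoff_sum T h n x) \<longleftrightarrow>
      (\<forall>C. \<exists>n. C < birkhoff_sum T h n x)" for x
    by (meson less_trans reals_Archimedean2)
  have shift: "(\<forall>C. \<exists>n. C < birkhoff_sum T h n (T x)) \<longleftrightarrow> (\<forall>C. \<exists>n. C < birkhoff_sum T h n x)" for x
  proof safe
    fix C assume "\<forall>C. \<exists>n. C < birkhoff_sum T h n (T x)"
    then obtain n where "C - h x < birkhoff_sum T h n (T x)" by blast
    then have "C < birkhoff_sum T h (Suc n) x" by (simp add: birkhoff_sum_Suc)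
    then show "\<exists>n. C < birkhoff_sum T h n x" ..
  next
    fix C assume "\<forall>C. \<exists>n. C < birkhoff_sum T h n x"
    \<comment> \<open>The 0 in the threshold excludes \<open>n = 0\<close>, where the sum vanishes,
      so that a first step can be split off.\<close>
    then obtain n where n: "max 0 (C + h x) < birkhoff_sum T h n x" by blast
    then obtain m where "n = Suc m" by (cases n) auto
    with n have "C < birkhoff_sum T h m (T x)" by (simp add: birkhoff_sum_Suc)
    then show "\<exists>n. C < birkhoff_sum T h n (T x)" ..
  qed
  have "T -` B \<inter> space M = B"
    using measurable_space[OF T(1)] by (auto simp: B_def unb_iff shift)
  with erg B have "prob B = 0 \<or> prob B = 1" by (simp add: ergodic_def)
  moreover have "prob B \<noteq> 1"
  proof
    assume "prob B = 1"
    then have "AE x in M. x \<in> B" using B by (simp add: prob_eq_1)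
    then have "AE x in M. \<exists>n. 0 < birkhoff_sum T h n x"
    proof eventually_elim
      case (elim x)
      then have "\<exists>n. real 0 < birkhoff_sum T h n x" unfolding B_def by blast
      then show ?case by simp
    qed
    then show False
      using integral_nonneg_if_AE_birkhoff_sum_pos[OF T h] neg by simp
  qed
  ultimately have "prob B = 0" by simp
  then have "AE x in M. x \<notin> B" using B by (simp add: prob_eq_0)
  then show ?thesis
    using AE_space by eventually_elim (auto simp: B_def unb_iff not_less)
qed

text \<open>Both \<open>f - (c + e)\<close> and \<open>(c - e) - f\<close> have integral
  \<open>-e < 0\<close>. Upper bounds on their sums confine the averages of \<open>f\<close> to
  within \<open>e\<close> of \<open>c\<close>, up to an error of order \<open>1 / n\<close>.\<close>

theorem birkhoff_ergodic:
  assumes erg: "ergodic M T" and f: "integrable M f"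
  shows "AE x in M. (\<lambda>n. birkhoff_sum T f n x / real n) \<longlonglongrightarrow> (\<integral>x. f x \<partial>M)"
proof -
  interpret prob_space M using erg by (simp add: ergodic_def)
  define c where "c = (\<integral>x. f x \<partial>M)"
  \<comment> \<open>A sequence of tolerances tending to 0: countably many null sets can be discarded
    together.\<close>
  define e where "e = (\<lambda>k. 1 / real (Suc k))"
  have e: "0 < e k" for k by (simp add: e_def)
  have "AE x in M. \<exists>C. \<forall>n. birkhoff_sum T (\<lambda>y. f y - (c + e k)) n x \<le> C" for k
    by (rule ergodic_birkhoff_sum_bounded_above[OF erg])
      (use f e[of k] in \<open>auto simp: c_def prob_space\<close>)
  moreover have "AE x in M. \<exists>C. \<forall>n. birkhoff_sum T (\<lambda>y. (c - e k) - f y) n x \<le> C" for k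
    by (rule ergodic_birkhoff_sum_bounded_above[OF erg])
      (use f e[of k] in \<open>auto simp: c_def prob_space\<close>)
  ultimately have "AE x in M. \<forall>k.
      (\<exists>C. \<forall>n. birkhoff_sum T (\<lambda>y. f y - (c + e k)) n x \<le> C) \<and>
      (\<exists>C. \<forall>n. birkhoff_sum T (\<lambda>y. (c - e k) - f y) n x \<le> C)"
    by (simp add: AE_all_countable)
  then show ?thesis
  proof eventually_elim
    case (elim x)
    show ?case unfolding c_def[symmetric]
    proof (rule LIMSEQ_I)
      fix r :: real assume r: "0 < r"
      obtain k where k: "e k < r / 2"
        using reals_Archimedean[of "r / 2"] r by (auto simp: e_def inverse_eq_divide)
      obtain C D
        where C: "\<And>n. birkhoff_sum T f n x - real n * (c + e k) \<le> C"
          and D: "\<And>n. real n * (c - e k) - birkhoff_sum T f n x \<le> D"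
        using elim[rule_format, of k]
        unfolding birkhoff_sum_diff_const birkhoff_sum_const_diff by blast
      \<comment> \<open>Half of \<open>r\<close> absorbs \<open>e k\<close>; beyond \<open>N\<close>
        the other half absorbs the constants \<open>C\<close> and \<open>D\<close> after division by
        \<open>n\<close>.\<close>
      obtain N where N: "2 * max C D / r < real N" using reals_Archimedean2 by blast
      show "\<exists>no. \<forall>n\<ge>no. norm (birkhoff_sum T f n x / real n - c) < r"
      proof (intro exI allI impI)
        \<comment> \<open>Starting at \<open>Suc N\<close> rather than \<open>N\<close> guarantees a
          positive divisor.\<close>
        fix n assume n: "Suc N \<le> n"
        have n0: "0 < real n" using n by simp
        have "2 * max C D / r < real n" using N n by linarith
        then have m: "max C D < real n * (r / 2)" using r by (simp add: field_simps)
        have k': "real n * e k < real n * (r / 2)" using k n0 by simp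
        have "\<bar>birkhoff_sum T f n x - real n * c\<bar> < real n * r"
          using m k' C[of n] D[of n] unfolding distrib_left right_diff_distrib by linarith
        moreover have "birkhoff_sum T f n x / real n - c
            = (birkhoff_sum T f n x - real n * c) / real n"
          using n0 by (simp add: field_simps)
        ultimately show "norm (birkhoff_sum T f n x / real n - c) < r"
          using n0 by (simp add: abs_divide field_simps)
      qed
    qed
  qed
qed

section \<open>Cesaro means of correlations\<close>

corollary ergodic_cesaro_mixing:
  assumes erg: "ergodic M T" and U: "U \<in> sets M" and V: "V \<in> sets M"
  shows "(\<lambda>n. (1 / real n) * (\<Sum>i<n. measure M (U \<inter> ((T ^^ i) -` V \<inter> space M))))
    \<longlonglongrightarrow> measure M U * measure M V"
proof -
  interpret prob_space M using erg by (simp add: ergodic_def)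
  have T: "T \<in> measurable M M" using erg by (auto simp: ergodic_def)
  let ?f = "indicator V :: _ \<Rightarrow> real"
  let ?g = "\<lambda>n x. indicator U x * (birkhoff_sum T ?f n x / real n)"
  have W: "U \<inter> ((T ^^ i) -` V \<inter> space M) \<in> sets M" for i
    using U measurable_sets[OF measurable_compose_n[OF T] V] by blast
  have "(\<integral>x. ?g n x \<partial>M) = (1 / real n) * (\<Sum>i<n. prob (U \<inter> ((T ^^ i) -` V \<inter> space M)))" for n
  proof -
    have "(\<integral>x. ?g n x \<partial>M)
        = (\<integral>x. (1 / real n) * (\<Sum>i<n. indicator (U \<inter> ((T ^^ i) -` V \<inter> space M)) x) \<partial>M)"
      by (rule Bochner_Integration.integral_cong)
        (auto simp: birkhoff_sum_def indicator_def sum_distrib_left intro!: sum.cong)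
    also have "\<dots> = (1 / real n) * (\<Sum>i<n. prob (U \<inter> ((T ^^ i) -` V \<inter> space M)))"
      using W by (simp add: emeasure_eq_measure)
    finally show ?thesis .
  qed
  moreover have "(\<lambda>n. \<integral>x. ?g n x \<partial>M) \<longlonglongrightarrow> (\<integral>x. indicator U x * prob V \<partial>M)"
  proof (rule integral_dominated_convergence[where w="\<lambda>_. 1"])
    have [measurable]: "birkhoff_sum T ?f n \<in> borel_measurable M" for n
      using borel_measurable_birkhoff_sum[OF T] V by simp
    note [measurable] = U
    show "(\<lambda>x. indicator U x * prob V) \<in> borel_measurable M" by measurable
    show "?g n \<in> borel_measurable M" for n by measurable
    show "AE x in M. norm (?g n x) \<le> 1" for n
    proof (rule AE_I2)
      fix x
      have "birkhoff_sum T ?f n x \<le> (\<Sum>i<n. 1)"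
        unfolding birkhoff_sum_def by (rule sum_mono) (simp add: indicator_def)
      moreover have "0 \<le> birkhoff_sum T ?f n x"
        unfolding birkhoff_sum_def by (rule sum_nonneg) simp
      ultimately show "norm (?g n x) \<le> 1"
        \<comment> \<open>For \<open>n = 0\<close> the quotient is 0 by the convention on division
          by zero.\<close>
        by (cases "n = 0") (auto simp: indicator_def)
    qed
    have "AE x in M. (\<lambda>n. birkhoff_sum T ?f n x / real n) \<longlonglongrightarrow> prob V"
      using birkhoff_ergodic[OF erg, of ?f] V by (simp add: emeasure_eq_measure)
    then show "AE x in M. (\<lambda>n. ?g n x) \<longlonglongrightarrow> indicator U x * prob V"
      by eventually_elim (intro tendsto_mult tendsto_const)
  qed simp
  moreover have "(\<integral>x. indicator U x * prob V \<partial>M) = prob U * prob V"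
    using U by simp
  ultimately show ?thesis by (simp only:)
qed

section \<open>Iterates of the skew product\<close>

lemma funpow_shift_map: "(shift_map ^^ i) x = (\<lambda>n. x (n + int i))"
  by (induction i) (auto simp: shift_map_def algebra_simps)

lemma factor_Suc: "factor x 0 (int (Suc i)) = factor x 0 (int i) @ [x (int i)]"
  by (simp add: factor_def upto_rec2)

text \<open>The letters of \<open>x\<close> must lie in \<open>A\<close> because
  \<open>\<phi>\<close> is multiplicative only on \<open>lists A\<close>. Each step multiplies on
  the right by the image of the next letter, so associativity gathers the whole word.\<close>

lemma funpow_skew_map:
  assumes G: "group G" and \<phi>: "onto_monoid_morphism A G \<phi>"
    and x: "\<And>n. x n \<in> A" and g: "g \<in> carrier G"
  shows "(skew_map G \<phi> ^^ i) (g, x) = (g \<otimes>\<^bsub>G\<^esub> \<phi> (factor x 0 (int i)), (shift_map ^^ i) x)"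
proof (induction i)
  case 0
  show ?case using G \<phi> g by (simp add: factor_def onto_monoid_morphism_def group.is_monoid)
next
  case (Suc i)
  interpret group G by fact
  have hom: "\<phi> \<in> hom (free_monoid A) G"
    using \<phi> by (simp add: onto_monoid_morphism_def epi_def)
  have w: "factor x 0 (int i) \<in> lists A" and a: "[x (int i)] \<in> lists A"
    using x by (auto simp: factor_def)
  have "\<phi> (factor x 0 (int i) @ [x (int i)]) = \<phi> (factor x 0 (int i)) \<otimes>\<^bsub>G\<^esub> \<phi> [x (int i)]"
    using hom_mult[OF hom, of "factor x 0 (int i)" "[x (int i)]"] w a
    by (simp add: free_monoid_def)
  moreover have "\<phi> (factor x 0 (int i)) \<in> carrier G" "\<phi> [x (int i)] \<in> carrier G"
    using hom_in_carrier[OF hom] w a by (auto simp: free_monoid_def)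
  ultimately show ?case
    using Suc g by (simp add: skew_map_def funpow_shift_map m_assoc factor_Suc del: of_nat_Suc)
qed

section \<open>The density of a group language\<close>

lemma space_ergodic_measure_on:
  assumes "shift_space A X" and "ergodic_measure_on A X \<mu>" and "x \<in> space \<mu>"
  shows "x n \<in> A"
proof -
  have "space \<mu> = X"
    using sets_eq_imp_space_eq[of \<mu> "shift_borel A X"] assms(2)
    by (simp add: ergodic_measure_on_def shift_borel_def space_measure_of_conv)
  moreover have "X \<subseteq> topspace (full_shift_topology A)"
    using assms(1) by (simp add: shift_space_def closedin_subset)
  ultimately show ?thesis
    using assms(3) by (auto simp: full_shift_topology_def PiE_def Pi_def)
qed

theorem corollary3p6:
  fixes A :: "'a set" and X :: "(int \<Rightarrow> 'a) set" and \<mu> :: "(int \<Rightarrow> 'a) measure"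
    and G :: "('g, 'm) monoid_scheme" and \<phi> :: "'a list \<Rightarrow> 'g"
    and K :: "'g set" and L :: "'a list set"
  assumes "shift_space A X"
    and "ergodic_measure_on A X \<mu>"
    and "group G" and "finite (carrier G)"
    and "onto_monoid_morphism A G \<phi>"
    and "ergodic (uniform_count_measure (carrier G) \<Otimes>\<^sub>M \<mu>) (skew_map G \<phi>)"
    and "K \<subseteq> carrier G"
    and "L = {w \<in> lists A. \<phi> w \<in> K}"
  shows "has_language_density \<mu> L (real (card K) / real (card (carrier G)))"
proof -
  interpret group G by fact
  let ?\<nu> = "uniform_count_measure (carrier G)"
  let ?T = "skew_map G \<phi>"
  let ?P = "?\<nu> \<Otimes>\<^sub>M \<mu>"
  let ?N = "real (card (carrier G))"
  define F where "F i = {x \<in> space \<mu>. factor x 0 (int i) \<in> L}" for i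
  interpret \<mu>: prob_space \<mu>
    using assms(2) by (simp add: ergodic_measure_on_def ergodic_def)
  have N: "0 < ?N" using assms(4) by (auto simp: card_gt_0_iff)
  have times: "measure ?P (H \<times> E) = real (card H) / ?N * measure \<mu> E"
    if "H \<subseteq> carrier G" "E \<in> sets \<mu>" for H E
  proof -
    have "emeasure ?P (H \<times> E) = emeasure ?\<nu> H * emeasure \<mu> E"
      using that by (intro \<mu>.emeasure_pair_measure_Times) (simp_all add: sets_uniform_count_measure)
    then show ?thesis
      using measure_uniform_count_measure[OF assms(4) that(1)]
      by (simp add: measure_def enn2real_mult)
  qed
  have U: "{\<one>\<^bsub>G\<^esub>} \<times> space \<mu> \<in> sets ?P" and V: "K \<times> space \<mu> \<in> sets ?P"
    using assms(7) by (auto intro!: pair_measureI simp: sets_uniform_count_measure)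
  have T: "?T \<in> measurable ?P ?P" using assms(6) by (simp add: ergodic_def)
  \<comment> \<open>Starting from the unit, the group coordinate after \<open>i\<close> steps is the
    image of the prefix of length \<open>i\<close>, and it lies in \<open>K\<close> exactly when
    that prefix is in \<open>L\<close>.\<close>
  have slice: "{\<one>\<^bsub>G\<^esub>} \<times> space \<mu> \<inter> ((?T ^^ i) -` (K \<times> space \<mu>) \<inter> space ?P) = {\<one>\<^bsub>G\<^esub>} \<times> F i"
    (is "?W i = _") for i
  proof -
    have "(\<one>\<^bsub>G\<^esub>, x) \<in> ?W i \<longleftrightarrow> x \<in> F i" if x: "x \<in> space \<mu>" for x
    proof -
      have xA: "x n \<in> A" for n
        using space_ergodic_measure_on[OF assms(1,2) x] .
      have w: "factor x 0 (int i) \<in> lists A" using xA by (auto simp: factor_def)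
      have "\<phi> (factor x 0 (int i)) \<in> carrier G"
        using hom_in_carrier[of \<phi> "free_monoid A" G] assms(5) w
        by (auto simp: onto_monoid_morphism_def epi_def free_monoid_def)
      moreover have "(\<one>\<^bsub>G\<^esub>, x) \<in> space ?P"
        using x by (simp add: space_pair_measure space_uniform_count_measure)
      \<comment> \<open>This puts the shifted point in \<open>space \<mu>\<close>, as the second
        factor of \<open>K \<times> space \<mu>\<close> demands.\<close>
      moreover from this have "(?T ^^ i) (\<one>\<^bsub>G\<^esub>, x) \<in> space ?P"
        by (rule measurable_space[OF measurable_compose_n[OF T]])
      ultimately show ?thesis
        using x w by (auto simp: F_def assms(8) funpow_skew_map[OF assms(3,5) xA] space_pair_measure)
    qed
    moreover have "F i \<subseteq> space \<mu>" by (auto simp: F_def)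
    ultimately show ?thesis by blast
  qed
  \<comment> \<open>Measurability is read off from the product: \<open>F i\<close> is the section at
    the unit of a measurable set.\<close>
  have F: "F i \<in> sets \<mu>" for i
  proof -
    have "{\<one>\<^bsub>G\<^esub>} \<times> F i \<in> sets ?P"
      using U measurable_sets[OF measurable_compose_n[OF T] V, of i] slice[of i]
      by (metis sets.Int)
    from sets_Pair1[OF this, of "\<one>\<^bsub>G\<^esub>"] show ?thesis by (simp add: vimage_def)
  qed
  have "(\<lambda>n. (1 / real n) * (\<Sum>i<n. measure ?P (?W i)))
      \<longlonglongrightarrow> measure ?P ({\<one>\<^bsub>G\<^esub>} \<times> space \<mu>) * measure ?P (K \<times> space \<mu>)"
    by (rule ergodic_cesaro_mixing[OF assms(6) U V])
  then have "(\<lambda>n. (1 / real n) * (\<Sum>i<n. measure \<mu> (F i) / ?N)) \<longlonglongrightarrow> 1 / ?N * (card K / ?N)"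
    using assms(7) F by (simp add: slice times \<mu>.prob_space)
  \<comment> \<open>Multiplying by the order of \<open>G\<close> undoes the weight of the fibre over
    the unit, on both sides of the limit.\<close>
  from tendsto_mult[OF tendsto_const[of ?N] this] show ?thesis
    unfolding has_language_density_def F_def[symmetric]
    using N by (simp add: sum_divide_distrib[symmetric])
qed

end
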